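(* Consider labeled chip-firing on the self-loop graph starting with $n$ chips with distinct labels from a totally ordered set, all at site $0$, where $n\equiv 3 \pmod 4$. When the process terminates (every site has at most $2$ chips), the chips are in weakly sorted order: for any chips $a<b$, the final position of $a$ is at most the final position of $b$, regardless of the choices of firing moves made.
   Context: The self-loop graph is the path graph on $\mathbb{Z}$ (each $i$ adjacent to $i\pm1$) with one self-loop at every vertex. A labeled firing move chooses three chips at a common site $i$; the one with the smallest label moves to $i-1$, the one with the largest label moves to $i+1$, and the third stays at $i$. *)

theory Defs
  imports Main
begin

text \<open>Labeled chip-firing on the self-loop graph (path on the integers with a loop at
every vertex). The chips are the elements of a finite set L of labels from a linearly
ordered type; a configuration assigns to each chip its site (values outside L are irrelevant).\<close>

definition fire_move :: "'a::linorder set \<Rightarrow> ('a \<Rightarrow> int) \<Rightarrow> ('a \<Rightarrow> int) \<Rightarrow> bool" where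
  "fire_move L p q \<longleftrightarrow>
     (\<exists>a b c. a \<in> L \<and> b \<in> L \<and> c \<in> L \<and> a < b \<and> b < c \<and>
        p a = p b \<and> p b = p c \<and> q = p(a := p a - 1, c := p c + 1))"

definition terminal :: "'a set \<Rightarrow> ('a \<Rightarrow> int) \<Rightarrow> bool" where
  "terminal L p \<longleftrightarrow> (\<forall>i::int. card {x \<in> L. p x = i} \<le> 2)"

end

theory Submission
  imports Defs
begin

text \<open>
Idea. By the 0-1 principle, colour the labels above a threshold as ones and the others as zeros; a
move then sorts its three colours, and one has to bound from below the number of ones on each tail.
Write n = 4m + 3 and let y(i) be the number of moves still to be made at site i. The final configuration is
1 2 ... 2 1 2 ... 2 1, so initially y(i) = (m + 1 - |i|)^2. Moves made when y(i) <= m + 1 - |i|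
can be postponed behind all other moves by commutation, hence the process passes through the
checkpoint y(i) = m + 1 - |i| with configuration 2 ... 2 3 2 ... 2. From there on every move finds
exactly three chips, so the process is a fixed sorting network, acting in a min-plus linear way on
the tail counts of the ones.

At the checkpoint the ones are stable on the negative sites. They always dominate a configuration
reached by unlabeled firing of k chips, and stability forces this to lie above the stabilisation
of k chips on the negative side. The same bound for the zeros is its mirror image. These bounds are
what the network needs in order to sort.
\<close>

section \<open>Two-coloured firing\<close>

text \<open>One of the three chips stays put, so a firing takes two chips from i; the loop shows
  only in the threshold three.\<close>

definition chips :: "int \<Rightarrow> (int \<Rightarrow> int) \<Rightarrow> int \<Rightarrow> int" where
  "chips n x i = (if i = 0 then n else 0) + x (i - 1) + x (i + 1) - 2 * x i"

text \<open>
N i counts the ones at sites >= i and x i the moves made at site i. Here l and r say whether the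
chips moved to the left and to the right are ones; l <= r expresses that the move sorts.
\<close>

definition step :: "int \<Rightarrow> int \<Rightarrow> (int \<Rightarrow> int) \<Rightarrow> (int \<Rightarrow> int) \<Rightarrow> (int \<Rightarrow> int) \<Rightarrow> (int \<Rightarrow> int) \<Rightarrow> bool" where
  "step n i N x N' x' \<longleftrightarrow> 3 \<le> chips n x i \<and> x' = x(i := x i + 1) \<and>
     (\<exists>l r. 0 \<le> l \<and> l \<le> r \<and> r \<le> 1 \<and>
        N' = N(i := N i - l, i + 1 := N (i + 1) + r) \<and>
        (l = 1 \<longrightarrow> 3 \<le> N i - N (i + 1)) \<and>
        (r = 1 \<longrightarrow> 1 \<le> N i - N (i + 1)) \<and>
        (r = 0 \<longrightarrow> 3 \<le> chips n x i - (N i - N (i + 1))) \<and>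
        (l = 0 \<longrightarrow> 1 \<le> chips n x i - (N i - N (i + 1))))"

text \<open>Tail counts of k chips at the origin; \<open>start n i + x (i - 1) - x i\<close> is then
  the number of chips at sites >= i after firing with odometer x.\<close>

definition start :: "int \<Rightarrow> int \<Rightarrow> int" where
  "start k i = (if i \<le> 0 then k else 0)"

inductive reach :: "int \<Rightarrow> int \<Rightarrow> (int \<Rightarrow> int) \<Rightarrow> (int \<Rightarrow> int) \<Rightarrow> bool" for n k where
  init: "reach n k (start k) (\<lambda>_. 0)"
| fire: "reach n k N x \<Longrightarrow> step n i N x N' x' \<Longrightarrow> reach n k N' x'"

inductive run :: "int \<Rightarrow> int set \<Rightarrow> (int \<Rightarrow> int) \<Rightarrow> (int \<Rightarrow> int) \<Rightarrow> (int \<Rightarrow> int) \<Rightarrow> (int \<Rightarrow> int) \<Rightarrow> bool"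
  for n S N x where
  stop: "run n S N x N x"
| fire: "run n S N x N' x' \<Longrightarrow> i \<in> S \<Longrightarrow> step n i N' x' N'' x'' \<Longrightarrow> run n S N x N'' x''"

lemma stepI:
  assumes "3 \<le> chips n x i" "0 \<le> l" "l \<le> r" "r \<le> 1"
    "N' = N(i := N i - l, i + 1 := N (i + 1) + r)"
    "l = 1 \<Longrightarrow> 3 \<le> N i - N (i + 1)" "r = 1 \<Longrightarrow> 1 \<le> N i - N (i + 1)"
    "r = 0 \<Longrightarrow> 3 \<le> chips n x i - (N i - N (i + 1))"
    "l = 0 \<Longrightarrow> 1 \<le> chips n x i - (N i - N (i + 1))"
  shows "step n i N x N' (x(i := x i + 1))"
  unfolding step_def using assms by blast

lemma stepE:
  assumes "step n i N x N' x'"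
  obtains l r where "3 \<le> chips n x i" "x' = x(i := x i + 1)"
    "N' = N(i := N i - l, i + 1 := N (i + 1) + r)"
    "l = 0 \<and> r = 0 \<and> 3 \<le> chips n x i - (N i - N (i + 1)) \<or>
     l = 0 \<and> r = 1 \<and> 1 \<le> N i - N (i + 1) \<and> 1 \<le> chips n x i - (N i - N (i + 1)) \<or>
     l = 1 \<and> r = 1 \<and> 3 \<le> N i - N (i + 1)"
proof -
  from assms obtain l r where *: "3 \<le> chips n x i" "x' = x(i := x i + 1)"
    "0 \<le> l" "l \<le> r" "r \<le> 1"
    "N' = N(i := N i - l, i + 1 := N (i + 1) + r)"
    "l = 1 \<longrightarrow> 3 \<le> N i - N (i + 1)" "r = 1 \<longrightarrow> 1 \<le> N i - N (i + 1)"
    "r = 0 \<longrightarrow> 3 \<le> chips n x i - (N i - N (i + 1))"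
    "l = 0 \<longrightarrow> 1 \<le> chips n x i - (N i - N (i + 1))"
    unfolding step_def by blast
  have "l = 0 \<and> r = 0 \<or> l = 0 \<and> r = 1 \<or> l = 1 \<and> r = 1" using *(3-5) by linarith
  then show thesis using * that by blast
qed

text \<open>A move at i reads and writes \<open>N\<close> only at i and i + 1, and its chip count
  reads x only at i - 1, i, i + 1. Moves at distance two or more do not interfere.\<close>

lemma step_commute:
  assumes "step n i N x N1 x1" "step n j N1 x1 N2 x2" "2 \<le> \<bar>i - j\<bar>"
  shows "\<exists>N3 x3. step n j N x N3 x3 \<and> step n i N3 x3 N2 x2"
proof -
  obtain l r where 1: "3 \<le> chips n x i" "x1 = x(i := x i + 1)"
    "0 \<le> l" "l \<le> r" "r \<le> 1"
    "N1 = N(i := N i - l, i + 1 := N (i + 1) + r)"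
    "l = 1 \<longrightarrow> 3 \<le> N i - N (i + 1)" "r = 1 \<longrightarrow> 1 \<le> N i - N (i + 1)"
    "r = 0 \<longrightarrow> 3 \<le> chips n x i - (N i - N (i + 1))"
    "l = 0 \<longrightarrow> 1 \<le> chips n x i - (N i - N (i + 1))"
    using assms(1) unfolding step_def by blast
  obtain l' r' where 2: "3 \<le> chips n x1 j" "x2 = x1(j := x1 j + 1)"
    "0 \<le> l'" "l' \<le> r'" "r' \<le> 1"
    "N2 = N1(j := N1 j - l', j + 1 := N1 (j + 1) + r')"
    "l' = 1 \<longrightarrow> 3 \<le> N1 j - N1 (j + 1)" "r' = 1 \<longrightarrow> 1 \<le> N1 j - N1 (j + 1)"
    "r' = 0 \<longrightarrow> 3 \<le> chips n x1 j - (N1 j - N1 (j + 1))"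
    "l' = 0 \<longrightarrow> 1 \<le> chips n x1 j - (N1 j - N1 (j + 1))"
    using assms(2) unfolding step_def by blast
  let ?N3 = "N(j := N j - l', j + 1 := N (j + 1) + r')"
  let ?x3 = "x(j := x j + 1)"
  have ne: "i \<noteq> j" "i \<noteq> j + 1" "j \<noteq> i + 1" "i + 1 \<noteq> j + 1" "i \<noteq> j - 1" "j \<noteq> i - 1"
    using assms(3) by auto
  have c: "chips n x1 j = chips n x j" "chips n ?x3 i = chips n x i"
    using ne unfolding chips_def 1(2) by auto
  have N: "N1 j = N j" "N1 (j + 1) = N (j + 1)" "?N3 i = N i" "?N3 (i + 1) = N (i + 1)"
    using ne unfolding 1(6) by auto
  have "step n j N x ?N3 ?x3"
    unfolding step_def using 2 unfolding c N by blast
  moreover have "N2 = ?N3(i := ?N3 i - l, i + 1 := ?N3 (i + 1) + r)"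
    unfolding 2(6) 1(6) using ne by (auto simp: fun_eq_iff)
  moreover have "x2 = ?x3(i := ?x3 i + 1)"
    unfolding 2(2) 1(2) using ne by (auto simp: fun_eq_iff)
  ultimately have "step n i ?N3 ?x3 N2 x2"
    unfolding step_def using 1 unfolding c N by blast
  then show ?thesis using \<open>step n j N x ?N3 ?x3\<close> by blast
qed

lemma run_commute:
  assumes "run n S N x N1 x1" "step n j N1 x1 N2 x2" "\<forall>i\<in>S. 2 \<le> \<bar>i - j\<bar>"
  shows "\<exists>N3 x3. step n j N x N3 x3 \<and> run n S N3 x3 N2 x2"
  using assms
proof (induction arbitrary: N2 x2)
  case stop
  then show ?case using run.stop by blast
next
  case (fire N' x' i N'' x'')
  obtain N3 x3 where 3: "step n j N' x' N3 x3" "step n i N3 x3 N2 x2"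
    using step_commute fire.hyps fire.prems by blast
  then show ?case using fire.IH[OF 3(1) fire.prems(2)] fire.hyps(2) run.fire by blast
qed

lemma run_mono: "run n S N x N' x' \<Longrightarrow> S \<subseteq> S' \<Longrightarrow> run n S' N x N' x'"
  by (induction rule: run.induct) (auto intro: run.intros)

section \<open>Stabilisation of unlabeled chips\<close>

text \<open>
The odometer stabilising n chips at the origin, where S = (n - 1) div 2 is the number of chips that
end up on each side of the origin.
\<close>

definition odo :: "int \<Rightarrow> int \<Rightarrow> int" where
  "odo S i = (max 0 (S + 1 - 2 * \<bar>i\<bar>))\<^sup>2 div 4"

lemma odo_nonneg: "0 \<le> odo S i"
  by (simp add: odo_def pos_imp_zdiv_nonneg_iff)

lemma odo_minus [simp]: "odo S (- i) = odo S i"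
  by (simp add: odo_def)

lemma odo_eq_0: "S \<le> 2 * \<bar>i\<bar> \<Longrightarrow> odo S i = 0"
proof -
  assume "S \<le> 2 * \<bar>i\<bar>"
  then have "max 0 (S + 1 - 2 * \<bar>i\<bar>) = 0 \<or> max 0 (S + 1 - 2 * \<bar>i\<bar>) = 1" by linarith
  then show ?thesis unfolding odo_def by auto
qed

text \<open>The difference is the net flow from i to i - 1, hence the number of chips ending left of
  i: two fewer for each site further left.\<close>

lemma odo_diff:
  assumes "i \<le> 0"
  shows "odo S i - odo S (i - 1) = max 0 (S + 2 * i)"
proof (cases "S + 2 * i \<le> 0")
  case True
  then show ?thesis using assms odo_eq_0[of S i] odo_eq_0[of S "i - 1"] by simp
next
  case False
  define s where "s = S - 1 + 2 * i"
  have a: "max 0 (S + 1 - 2 * \<bar>i\<bar>) = s + 2" "max 0 (S + 1 - 2 * \<bar>i - 1\<bar>) = s"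
    using assms False unfolding s_def by auto
  \<comment> \<open>The bases differ by 2, so the squares differ by a multiple of 4 and the floors
    subtract exactly.\<close>
  have "(s + 2)\<^sup>2 = s\<^sup>2 + (s + 1) * 4" by (simp add: power2_eq_square algebra_simps)
  then have "(s + 2)\<^sup>2 div 4 = s\<^sup>2 div 4 + (s + 1)" by simp
  then show ?thesis unfolding odo_def a using False s_def by simp
qed

lemma odo_diff_right:
  assumes "0 \<le> i"
  shows "odo S i - odo S (i + 1) = max 0 (S - 2 * i)"
proof -
  have "odo S (- i) - odo S (- i - 1) = max 0 (S - 2 * i)"
    using odo_diff[of "- i" S] assms by simp
  moreover have "odo S (- i - 1) = odo S (i + 1)" by (metis minus_add_distrib odo_minus uminus_add_conv_diff diff_conv_add_uminus)
  ultimately show ?thesis by simp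
qed

lemma chips_odo:
  "chips n (odo S) i = (if i = 0 then n - 2 * max 0 S
     else max 0 (S + 2 - 2 * \<bar>i\<bar>) - max 0 (S - 2 * \<bar>i\<bar>))"
proof -
  consider "i = 0" | "i < 0" | "i > 0" by linarith
  then show ?thesis
  proof cases
    case 1
    then show ?thesis using odo_diff[of 0 S] odo_diff_right[of 0 S] by (simp add: chips_def)
  next
    case 2
    then show ?thesis using odo_diff[of i S] odo_diff[of "i + 1" S] by (simp add: chips_def algebra_simps)
  next
    case 3
    then show ?thesis using odo_diff_right[of i S] odo_diff_right[of "i - 1" S] by (simp add: chips_def algebra_simps)
  qed
qed

lemma chips_odo_le: "n \<le> 2 * S + 2 \<Longrightarrow> -1 \<le> S \<Longrightarrow> chips n (odo S) i \<le> 2"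
  unfolding chips_odo by auto

lemma chips_odo_neg: "i < 0 \<Longrightarrow> 0 < odo S i \<Longrightarrow> chips n (odo S) i = 2"
  using odo_eq_0[of S i] unfolding chips_odo by (cases "S \<le> 2 * \<bar>i\<bar>") simp_all

text \<open>If u had already reached \<open>odo S\<close> at i, the neighbours would have sent at
  most as many chips as under \<open>odo S\<close>, which leaves at most two chips at i.\<close>

lemma least_action:
  assumes "\<forall>i. u i \<le> odo S i" "n \<le> 2 * S + 2" "-1 \<le> S" "3 \<le> chips n u i"
  shows "u i < odo S i"
proof (rule ccontr)
  assume "\<not> u i < odo S i"
  then have "u i = odo S i" using assms(1) by (meson antisym_conv2)
  then have "chips n u i \<le> chips n (odo S) i"
    using assms(1)[rule_format, of "i - 1"] assms(1)[rule_format, of "i + 1"] by (simp add: chips_def)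
  then show False using chips_odo_le[OF assms(2,3), of i] assms(4) by linarith
qed

section \<open>Invariants of reachable states\<close>

lemma reach_odometer:
  assumes "reach n k N x" "n \<le> 2 * S + 2" "-1 \<le> S"
  shows "0 \<le> x i \<and> x i \<le> odo S i"
  using assms(1)
proof (induction arbitrary: i)
  case init
  then show ?case by (simp add: odo_nonneg)
next
  case (fire N x j N' x')
  obtain "3 \<le> chips n x j" "x' = x(j := x j + 1)" using fire.hyps(2) by (rule stepE)
  then show ?case using fire.IH least_action[of x S n j] assms(2,3) by (auto simp: less_imp_le)
qed

lemma reach_between:
  assumes "reach n k N x" "0 \<le> k" "k \<le> n"
  shows "0 \<le> N i - N (i + 1) \<and> N i - N (i + 1) \<le> chips n x i"
  using assms(1)
proof (induction arbitrary: i)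
  case init
  then show ?case using assms by (auto simp: start_def chips_def)
next
  case (fire N x j N' x')
  obtain l r where s: "3 \<le> chips n x j" "x' = x(j := x j + 1)"
    "N' = N(j := N j - l, j + 1 := N (j + 1) + r)"
    "l = 0 \<and> r = 0 \<and> 3 \<le> chips n x j - (N j - N (j + 1)) \<or>
     l = 0 \<and> r = 1 \<and> 1 \<le> N j - N (j + 1) \<and> 1 \<le> chips n x j - (N j - N (j + 1)) \<or>
     l = 1 \<and> r = 1 \<and> 3 \<le> N j - N (j + 1)"
    using fire.hyps(2) by (rule stepE)
  have IH: "0 \<le> N i - N (i + 1)" "N i - N (i + 1) \<le> chips n x i" for i
    using fire.IH by auto
  consider "i = j" | "i = j + 1" | "i = j - 1" | "i < j - 1 \<or> j + 1 < i" by linarith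
  then show ?case
  proof cases
    case 1
    then show ?thesis using s IH[of j] by (auto simp: chips_def)
  next
    case 2
    then show ?thesis using s IH[of i] IH[of j] by (auto simp: chips_def)
  next
    case 3
    then show ?thesis using s IH[of i] IH[of j] by (auto simp: chips_def)
  next
    case 4
    then show ?thesis using s IH[of i] IH[of j] by (auto simp: chips_def)
  qed
qed

text \<open>A tail of the ones shrinks only when three ones meet, and this is a move of the ones
  alone. So k unlabeled chips, fired suitably, stay below the ones in every tail.\<close>

lemma reach_dominates:
  assumes "reach n k N x" "k \<le> 2 * S + 2" "-1 \<le> S"
  shows "\<exists>u. (\<forall>i. 0 \<le> u i \<and> u i \<le> odo S i) \<and> (\<forall>i. start k i + u (i - 1) - u i \<le> N i)"
  using assms(1)
proof induction
  case init
  show ?case by (rule exI[of _ "\<lambda>_. 0"]) (simp add: odo_nonneg)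
next
  case (fire N x j N' x')
  obtain u where u: "\<forall>i. 0 \<le> u i \<and> u i \<le> odo S i" "\<forall>i. start k i + u (i - 1) - u i \<le> N i"
    using fire.IH by blast
  obtain l r where s: "3 \<le> chips n x j" "x' = x(j := x j + 1)"
    "N' = N(j := N j - l, j + 1 := N (j + 1) + r)"
    "l = 0 \<and> r = 0 \<and> 3 \<le> chips n x j - (N j - N (j + 1)) \<or>
     l = 0 \<and> r = 1 \<and> 1 \<le> N j - N (j + 1) \<and> 1 \<le> chips n x j - (N j - N (j + 1)) \<or>
     l = 1 \<and> r = 1 \<and> 3 \<le> N j - N (j + 1)"
    using fire.hyps(2) by (rule stepE)
  \<comment> \<open>Fire the dominated configuration only when domination would otherwise fail; it then has at
    least as many chips at j as there are ones.\<close>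
  show ?case
  proof (cases "start k j + u (j - 1) - u j \<le> N j - l")
    case True
    have "start k i + u (i - 1) - u i \<le> N' i" for i
      using True s(3,4) u(2)[rule_format, of i] by auto
    then show ?thesis using u(1) by blast
  next
    case False
    then have l: "l = 1" "r = 1" "3 \<le> N j - N (j + 1)" "start k j + u (j - 1) - u j = N j"
      using s(4) u(2)[rule_format, of j] by auto
    have "start k j - start k (j + 1) = (if j = 0 then k else 0)" by (auto simp: start_def)
    then have "3 \<le> chips k u j"
      using l u(2)[rule_format, of "j + 1"] unfolding chips_def by (simp add: algebra_simps)
    then have "u j < odo S j" using least_action[of u S k j] u(1) assms by blast
    moreover have "start k i + (u(j := u j + 1)) (i - 1) - (u(j := u j + 1)) i \<le> N' i" for i
      using s(3) l u(2)[rule_format, of i] by auto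
    ultimately show ?thesis using u(1)
      by (intro exI[of _ "u(j := u j + 1)"]) auto
  qed
qed

section \<open>Lower bound for configurations stable on the negative side\<close>

lemma convex_increasing_left:
  fixes D :: "int \<Rightarrow> int"
  assumes "\<And>i. 0 \<le> D i" "\<And>i. i \<le> - b \<Longrightarrow> D i = 0"
    "\<And>i. i < 0 \<Longrightarrow> 0 < D i \<Longrightarrow> 2 * D i \<le> D (i - 1) + D (i + 1)" "i \<le> 0"
  shows "D (i - 1) = 0 \<or> D (i - 1) < D i"
proof (rule ccontr)
  assume "\<not> (D (i - 1) = 0 \<or> D (i - 1) < D i)"
  then have a: "0 < D (i - 1)" "D i \<le> D (i - 1)" using assms(1)[of "i - 1"] by auto
  \<comment> \<open>Convexity carries a non-increase at a positive value to the left forever,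
    contradicting the vanishing of D far out.\<close>
  have "D (i - int j) \<le> D (i - int j - 1) \<and> 0 < D (i - int j - 1)" for j
  proof (induction j)
    case 0
    then show ?case using a by simp
  next
    case (Suc j)
    then show ?case using assms(3)[of "i - int j - 1"] assms(4) by (simp add: algebra_simps)
  qed
  from this[of "nat (\<bar>i\<bar> + \<bar>b\<bar>)"] have "0 < D (i - (\<bar>i\<bar> + \<bar>b\<bar>) - 1)" by simp
  moreover have "D (i - (\<bar>i\<bar> + \<bar>b\<bar>) - 1) = 0" by (rule assms(2)) linarith
  ultimately show False by linarith
qed

text \<open>The bound is the tail of k stabilised chips. A largest dominated u has a deficit D that
  does not decrease towards the origin, so u sends no more chips left across any edge than
  \<open>odo S\<close> does.\<close>

lemma reach_stable_dominates:
  assumes "reach n k N x" "k \<le> 2 * S + 2" "-1 \<le> S"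
    and stable: "\<And>i. i < 0 \<Longrightarrow> N i - N (i + 1) \<le> 2" and "i \<le> 0"
  shows "k - max 0 (S + 2 * i) \<le> N i"
proof -
  define P where "P = (\<lambda>u. (\<forall>i. 0 \<le> u i \<and> u i \<le> odo S i) \<and> (\<forall>i. start k i + u (i - 1) - u i \<le> N i))"
  \<comment> \<open>Outside this window \<open>odo S\<close> vanishes, so the sum over A measures
    all of u.\<close>
  define A where "A = {- (\<bar>S\<bar> + 1)..\<bar>S\<bar> + 1}"
  obtain u0 where u0: "P u0" using reach_dominates[OF assms(1-3)] unfolding P_def by blast
  have "\<forall>u. P u \<longrightarrow> nat (sum u A) < nat (sum (odo S) A) + 1"
  proof (intro allI impI)
    fix u assume "P u"
    then have "sum u A \<le> sum (odo S) A" unfolding P_def by (intro sum_mono) blast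
    then show "nat (sum u A) < nat (sum (odo S) A) + 1" by linarith
  qed
  then obtain u where u: "P u" "\<And>v. P v \<Longrightarrow> nat (sum v A) \<le> nat (sum u A)"
    using ex_has_greatest_nat[of P u0 "\<lambda>u. nat (sum u A)"] u0 by blast
  \<comment> \<open>For u of maximal sum, no site with D > 0 can be fired without losing domination.\<close>
  define D where "D = (\<lambda>i. odo S i - u i)"
  have D0: "0 \<le> D i" for i using u(1) unfolding P_def D_def by simp
  have zero: "odo S i = 0" if "i \<notin> A" for i
    using that odo_eq_0[of S i] unfolding A_def by auto
  have Dz: "D i = 0" if "i \<notin> A" for i
    using that zero[OF that] u(1) unfolding P_def D_def by (metis antisym diff_self)
  have conv: "2 * D i \<le> D (i - 1) + D (i + 1)" if "i < 0" "0 < D i" for i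
  proof -
    have "i \<in> A" using Dz that by fastforce
    let ?v = "u(i := u i + 1)"
    have "finite A" unfolding A_def by simp
    have "sum ?v A = sum u A + 1"
      using \<open>finite A\<close> \<open>i \<in> A\<close> by (simp add: sum.remove[of A i] algebra_simps)
    moreover have "0 \<le> sum u A" using u(1) unfolding P_def by (simp add: sum_nonneg)
    ultimately have "\<not> P ?v" using u(2)[of ?v] by auto
    moreover have "\<forall>j. 0 \<le> ?v j \<and> ?v j \<le> odo S j"
      using u(1) that unfolding P_def D_def by auto
    ultimately obtain j where j: "N j < start k j + ?v (j - 1) - ?v j" unfolding P_def by (meson not_le)
    have "start k j + u (j - 1) - u j \<le> N j" using u(1) unfolding P_def by blast
    \<comment> \<open>Raising u at i raises the lower bound only at i + 1, so it was tight there;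
      hence site i holds at least \<open>chips k u i\<close> ones.\<close>
    then have "j = i + 1" using j by (auto split: if_splits)
    then have "N (i + 1) \<le> start k (i + 1) + u i - u (i + 1)" using j by auto
    moreover have "start k i + u (i - 1) - u i \<le> N i" using u(1) unfolding P_def by blast
    ultimately have "chips k u i \<le> 2"
      using stable[of i] that unfolding chips_def start_def by simp
    moreover have "0 \<le> u i" using u(1) unfolding P_def by blast
    then have "chips k (odo S) i = 2" using chips_odo_neg[of i S k] that unfolding D_def by auto
    ultimately show ?thesis unfolding chips_def D_def by simp
  qed
  have "D (i - 1) = 0 \<or> D (i - 1) < D i"
    by (rule convex_increasing_left[of D "\<bar>S\<bar> + 2"]) (use D0 Dz conv assms(5) in \<open>auto simp: A_def\<close>)
  then have "D (i - 1) \<le> D i" using D0[of i] by auto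
  moreover have "start k i + u (i - 1) - u i \<le> N i" using u(1) unfolding P_def by blast
  ultimately show ?thesis using odo_diff[of i S] assms(5) unfolding D_def start_def by auto
qed

text \<open>The tail counts after reflecting the line and exchanging the two colours.\<close>

definition flip :: "int \<Rightarrow> int \<Rightarrow> (int \<Rightarrow> int) \<Rightarrow> (int \<Rightarrow> int) \<Rightarrow> int \<Rightarrow> int" where
  "flip n k N x i = n - k - (start n (1 - i) + x (- i) - x (1 - i)) + N (1 - i)"

text \<open>Reflection exchanges left and right and recolouring complements, so (l, r) becomes (1 -
  r, 1 - l), which is again sorted.\<close>

lemma step_flip:
  assumes "step n i N x N' x'"
  shows "step n (- i) (flip n k N x) (\<lambda>j. x (- j)) (flip n k N' x') (\<lambda>j. x' (- j))"
proof -
  obtain l r where s: "3 \<le> chips n x i" "x' = x(i := x i + 1)"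
    "N' = N(i := N i - l, i + 1 := N (i + 1) + r)"
    "l = 0 \<and> r = 0 \<and> 3 \<le> chips n x i - (N i - N (i + 1)) \<or>
     l = 0 \<and> r = 1 \<and> 1 \<le> N i - N (i + 1) \<and> 1 \<le> chips n x i - (N i - N (i + 1)) \<or>
     l = 1 \<and> r = 1 \<and> 3 \<le> N i - N (i + 1)"
    using assms by (rule stepE)
  let ?M = "flip n k N x"
  have c: "chips n (\<lambda>j. x (- j)) (- i) = chips n x i"
    unfolding chips_def by (simp add: add.commute)
  have d: "?M (- i) - ?M (- i + 1) = chips n x i - (N i - N (i + 1))"
    unfolding flip_def chips_def start_def by (auto simp: add.commute)
  have x: "(\<lambda>j. x' (- j)) = (\<lambda>j. x (- j))(- i := x (- (- i)) + 1)"
    unfolding s(2) by (auto simp: fun_eq_iff)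
  have M: "flip n k N' x' = ?M(- i := ?M (- i) - (1 - r), - i + 1 := ?M (- i + 1) + (1 - l))"
    unfolding s(2,3) by (auto simp: flip_def fun_eq_iff add.commute)
  show ?thesis
    unfolding step_def c d
    by (intro conjI exI[of _ "1 - r"] exI[of _ "1 - l"]) (use s(1,4) x M in auto)
qed

lemma reach_flip:
  assumes "reach n k N x"
  shows "reach n (n - k) (flip n k N x) (\<lambda>j. x (- j))"
  using assms
proof induction
  case init
  have "flip n k (start k) (\<lambda>_. 0) = start (n - k)"
    by (auto simp: flip_def start_def fun_eq_iff)
  then show ?case using reach.init[of n "n - k"] by simp
next
  case (fire N x i N' x')
  then show ?case using step_flip reach.fire by blast
qed

text \<open>Where positive, the deficit D grows strictly towards the origin from both sides. A
  positive peak at 0 would violate convexity by at least 2, but \<open>odo\<close> leaves one chip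
  there, which permits a violation of only 1.\<close>

lemma terminal_odometer:
  assumes "reach n k N x" "n = 4 * m + 3" "0 \<le> m" and stable: "\<And>i. chips n x i \<le> 2"
  shows "x = odo (2 * m + 1)"
proof -
  define D where "D = (\<lambda>i. odo (2 * m + 1) i - x i)"
  have bd: "0 \<le> x i" "x i \<le> odo (2 * m + 1) i" for i
    using reach_odometer[OF assms(1), of "2 * m + 1" i] assms(2,3) by auto
  have D0: "0 \<le> D i" for i using bd unfolding D_def by simp
  have Dz: "D i = 0" if "m < \<bar>i\<bar>" for i
    using bd[of i] odo_eq_0[of "2 * m + 1" i] that unfolding D_def by simp
  have conv: "chips n (odo (2 * m + 1)) i - 2 \<le> D (i - 1) + D (i + 1) - 2 * D i" for i
    using stable[of i] unfolding chips_def D_def by simp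
  have conv0: "2 * D 0 - 1 \<le> D (- 1) + D 1"
    using conv[of 0] assms(2,3) unfolding chips_odo by simp
  have conv1: "2 * D i \<le> D (i - 1) + D (i + 1)" if "i \<noteq> 0" "0 < D i" for i
  proof -
    have "\<bar>i\<bar> \<le> m" using Dz[of i] that by fastforce
    then show ?thesis using conv[of i] that unfolding chips_odo by auto
  qed
  have left: "D (i - 1) = 0 \<or> D (i - 1) < D i" if "i \<le> 0" for i
    by (rule convex_increasing_left[of D "m + 1"]) (use D0 Dz conv1 that assms(3) in auto)
  have right: "D (- (i - 1)) = 0 \<or> D (- (i - 1)) < D (- i)" if "i \<le> 0" for i
  proof (rule convex_increasing_left[of "\<lambda>i. D (- i)" "m + 1"])
    show "2 * D (- i) \<le> D (- (i - 1)) + D (- (i + 1))" if "i < 0" "0 < D (- i)" for i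
    proof -
      have "- i - 1 = - (i + 1)" "- i + 1 = - (i - 1)" by simp_all
      then show ?thesis using conv1[of "- i"] that by simp
    qed
  qed (use D0 Dz that assms(3) in auto)
  have "D 0 = 0" using left[of 0] right[of 0] conv0 D0[of 0] by auto
  moreover have "D (- int j) = 0 \<and> D (int j) = 0" for j
  proof (induction j)
    case (Suc j)
    show ?case
    proof -
      have "- int (Suc j) = - int j - 1" "int (Suc j) = - (- int j - 1)" by simp_all
      then show ?thesis
        using Suc left[of "- int j"] right[of "- int j"] D0[of "- int j - 1"] D0[of "- (- int j - 1)"]
        by (simp only: minus_minus) linarith
    qed
  qed (use \<open>D 0 = 0\<close> in simp)
  then have "D i = 0" for i by (metis int_cases2)
  then show ?thesis unfolding D_def by (auto simp: fun_eq_iff)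
qed

section \<open>The checkpoint\<close>

text \<open>The square root of the stabilising odometer of 4m + 3 chips: the number of moves at i
  reserved for the last phase.\<close>

definition bump :: "int \<Rightarrow> int \<Rightarrow> int" where
  "bump m i = max 0 (m + 1 - \<bar>i\<bar>)"

lemma odo_bump: "odo (2 * m + 1) i = (bump m i)\<^sup>2"
proof -
  have "max 0 (2 * m + 1 + 1 - 2 * \<bar>i\<bar>) = 2 * bump m i"
    unfolding bump_def by (auto simp: max_def)
  then show ?thesis unfolding odo_def by (simp add: power_mult_distrib)
qed

lemma bump_le_odo: "bump m i \<le> odo (2 * m + 1) i"
proof -
  have "0 \<le> bump m i" unfolding bump_def by simp
  then show ?thesis
    unfolding odo_bump power2_eq_square by (cases "bump m i = 0") (simp_all add: mult_le_cancel_left1)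
qed

definition staircase :: "(int \<Rightarrow> int) \<Rightarrow> bool" where
  "staircase z \<longleftrightarrow> (\<forall>i\<ge>1. z (i - 1) - z i \<in> {0, 1}) \<and> (\<forall>i\<le>-1. z (i + 1) - z i \<in> {0, 1})"

lemma staircase_bump: "0 \<le> m \<Longrightarrow> staircase (bump m)"
  unfolding staircase_def bump_def by auto

text \<open>Three chips at j force the second difference of y to be at most -1, or -2 at the origin.
  A staircase below y that touches it at j allows nothing smaller, so every inequality is
  tight.\<close>

lemma staircase_fire:
  assumes "staircase z" "\<And>i. z i \<le> y i" "z j = y j" "n = 4 * m + 3" "0 \<le> m"
    "3 \<le> chips n (\<lambda>i. odo (2 * m + 1) i - y i) j"
  shows "y (j - 1) = z (j - 1)" "y (j + 1) = z (j + 1)" "staircase (z(j := z j - 1))"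
    "chips n (\<lambda>i. odo (2 * m + 1) i - y i) j = 3"
    "0 < j \<Longrightarrow> z (j - 1) = z j \<and> z (j + 1) = z j - 1"
    "j < 0 \<Longrightarrow> z (j + 1) = z j \<and> z (j - 1) = z j - 1"
    "j = 0 \<Longrightarrow> z (j + 1) = z j - 1 \<and> z (j - 1) = z j - 1"
proof -
  have c: "chips n (\<lambda>i. odo (2 * m + 1) i - y i) j
      = chips n (odo (2 * m + 1)) j - (y (j - 1) + y (j + 1) - 2 * y j)"
    unfolding chips_def by simp
  have o: "chips n (odo (2 * m + 1)) j \<le> (if j = 0 then 1 else 2)"
    unfolding chips_odo using assms(4,5) by auto
  have s: "1 \<le> i \<Longrightarrow> z (i - 1) - z i = 0 \<or> z (i - 1) - z i = 1"
    "i \<le> -1 \<Longrightarrow> z (i + 1) - z i = 0 \<or> z (i + 1) - z i = 1" for i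
    using assms(1) unfolding staircase_def by auto
  have zy: "z (j - 1) \<le> y (j - 1)" "z (j + 1) \<le> y (j + 1)" by (rule assms(2))+
  have e: "(0 < j \<longrightarrow> z (j - 1) = z j \<and> z (j + 1) = z j - 1) \<and>
     (j < 0 \<longrightarrow> z (j + 1) = z j \<and> z (j - 1) = z j - 1) \<and>
     (j = 0 \<longrightarrow> z (j + 1) = z j - 1 \<and> z (j - 1) = z j - 1) \<and>
     y (j - 1) = z (j - 1) \<and> y (j + 1) = z (j + 1) \<and>
     chips n (\<lambda>i. odo (2 * m + 1) i - y i) j = 3"
  proof -
    consider "0 < j" | "j < 0" | "j = 0" by linarith
    then show ?thesis
    proof cases
      case 1
      then show ?thesis using s(1)[of j] s(1)[of "j + 1"] zy assms(3,6) c o by auto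
    next
      case 2
      then show ?thesis using s(2)[of j] s(2)[of "j - 1"] zy assms(3,6) c o by auto
    next
      case 3
      then show ?thesis using s(1)[of "j + 1"] s(2)[of "j - 1"] zy assms(3,6) c o by auto
    qed
  qed
  then show "y (j - 1) = z (j - 1)" "y (j + 1) = z (j + 1)"
    "chips n (\<lambda>i. odo (2 * m + 1) i - y i) j = 3"
    "0 < j \<Longrightarrow> z (j - 1) = z j \<and> z (j + 1) = z j - 1"
    "j < 0 \<Longrightarrow> z (j + 1) = z j \<and> z (j - 1) = z j - 1"
    "j = 0 \<Longrightarrow> z (j + 1) = z j - 1 \<and> z (j - 1) = z j - 1" by auto
  let ?z = "z(j := z j - 1)"
  have "?z (i - 1) - ?z i = 0 \<or> ?z (i - 1) - ?z i = 1" if "1 \<le> i" for i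
  proof -
    consider "i = j" | "i = j + 1" | "i \<noteq> j" "i \<noteq> j + 1" by blast
    then show ?thesis
    proof cases
      case 1
      then have "z (j - 1) = z j" using e that by simp
      then show ?thesis using 1 by simp
    next
      case 2
      then have "z (j + 1) = z j - 1" using e that by (cases "j = 0") simp_all
      then show ?thesis using 2 by simp
    next
      case 3
      then show ?thesis using s(1)[OF that] by auto
    qed
  qed
  moreover have "?z (i + 1) - ?z i = 0 \<or> ?z (i + 1) - ?z i = 1" if "i \<le> -1" for i
  proof -
    consider "i = j" | "i = j - 1" | "i \<noteq> j" "i \<noteq> j - 1" by blast
    then show ?thesis
    proof cases
      case 1
      then have "z (j + 1) = z j" using e that by simp
      then show ?thesis using 1 by simp
    next
      case 2
      then have "z (j - 1) = z j - 1" using e that by (cases "j = 0") simp_all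
      then show ?thesis using 2 by simp
    next
      case 3
      then show ?thesis using s(2)[OF that] by auto
    qed
  qed
  ultimately show "staircase ?z" unfolding staircase_def by simp
qed

text \<open>
A site that has entered the last phase forces its neighbours to have entered it as well, so a move
of the first phase commutes with all moves of the last phase made so far.
\<close>

lemma reach_split:
  assumes "reach n k N x" "n = 4 * m + 3" "0 \<le> m"
  defines "y \<equiv> \<lambda>x i. odo (2 * m + 1) i - x i"
  shows "staircase (\<lambda>i. min (bump m i) (y x i)) \<and>
    (\<forall>i. y x i < bump m i \<longrightarrow> y x (i - 1) \<le> bump m (i - 1) \<and> y x (i + 1) \<le> bump m (i + 1)) \<and>
    (\<exists>N0. reach n k N0 (\<lambda>i. odo (2 * m + 1) i - max (bump m i) (y x i)) \<and>
      run n {i. y x i < bump m i} N0 (\<lambda>i. odo (2 * m + 1) i - max (bump m i) (y x i)) N x)"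
  using assms(1)
proof induction
  case init
  have "min (bump m i) (y (\<lambda>_. 0) i) = bump m i" "max (bump m i) (y (\<lambda>_. 0) i) = odo (2 * m + 1) i"
    "\<not> y (\<lambda>_. 0) i < bump m i" for i
    using bump_le_odo[of m i] unfolding y_def by auto
  then show ?case using staircase_bump[OF assms(3)] reach.init run.stop by (simp, blast)
next
  case (fire N x j N' x')
  define z where "z = (\<lambda>i. min (bump m i) (y x i))"
  \<comment> \<open>The odometer of the first-phase moves alone: x capped at
    \<open>odo - bump\<close>.\<close>
  define x0 where "x0 = (\<lambda>x i. odo (2 * m + 1) i - max (bump m i) (y x i))"
  have x': "x' = x(j := x j + 1)" and c: "3 \<le> chips n x j" using fire.hyps(2) by (auto elim: stepE)
  have y': "y x' = (y x)(j := y x j - 1)" unfolding y_def x' by auto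
  have y'_le: "y x' i \<le> y x i" for i unfolding y' by simp
  have c': "3 \<le> chips n (\<lambda>i. odo (2 * m + 1) i - y x i) j" using c by (simp add: y_def)
  from fire.IH obtain N0 where IH: "staircase z"
    "\<And>i. y x i < bump m i \<Longrightarrow> y x (i - 1) \<le> bump m (i - 1) \<and> y x (i + 1) \<le> bump m (i + 1)"
    "reach n k N0 (x0 x)" "run n {i. y x i < bump m i} N0 (x0 x) N x"
    unfolding z_def x0_def by blast
  show ?case
  proof (cases "bump m j < y x j")
    case True
    have S: "{i. y x' i < bump m i} = {i. y x i < bump m i}" using True unfolding y' by auto
    have z: "(\<lambda>i. min (bump m i) (y x' i)) = z" using True unfolding z_def y' by (auto simp: fun_eq_iff)
    have x0': "x0 x' = (x0 x)(j := x0 x j + 1)" using True unfolding x0_def y' by (auto simp: fun_eq_iff)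
    \<comment> \<open>Neighbours of a site in the last phase have at most \<open>bump\<close> moves
      left, whereas j has more.\<close>
    have "2 \<le> \<bar>i - j\<bar>" if "y x i < bump m i" for i
    proof -
      have "j \<noteq> i" "j \<noteq> i - 1" "j \<noteq> i + 1" using IH(2)[OF that] True that by auto
      then show ?thesis by linarith
    qed
    then obtain N3 x3 where 3: "step n j N0 (x0 x) N3 x3" "run n {i. y x i < bump m i} N3 x3 N' x'"
      using run_commute[OF IH(4) fire.hyps(2)] by blast
    have "x3 = x0 x'" using 3(1) x0' by (auto elim: stepE)
    then have "reach n k N3 (x0 x')" "run n {i. y x' i < bump m i} N3 (x0 x') N' x'"
      using 3 IH(3) S reach.fire by auto
    moreover have "y x' (i - 1) \<le> bump m (i - 1) \<and> y x' (i + 1) \<le> bump m (i + 1)"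
      if "y x' i < bump m i" for i
    proof -
      have "y x i < bump m i" using that S by blast
      from IH(2)[OF this] show ?thesis using y'_le[of "i - 1"] y'_le[of "i + 1"] by linarith
    qed
    moreover have "staircase (\<lambda>i. min (bump m i) (y x' i))" unfolding z by (rule IH(1))
    ultimately show ?thesis unfolding x0_def by blast
  next
    case False
    have zj: "z j = y x j" using False unfolding z_def by simp
    have zy: "z i \<le> y x i" for i unfolding z_def by simp
    note f = staircase_fire[OF IH(1) zy zj assms(2,3) c']
    have zle: "z i \<le> bump m i" for i unfolding z_def by simp
    have "(\<lambda>i. min (bump m i) (y x' i)) = z(j := z j - 1)"
      using False zj unfolding z_def y' by (auto simp: fun_eq_iff)
    then have 1: "staircase (\<lambda>i. min (bump m i) (y x' i))" using f(3) by simp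
    \<comment> \<open>Tightness makes y agree with z next to j, and z lies below
      \<open>bump\<close>.\<close>
    have near: "y x (j - 1) \<le> bump m (j - 1)" "y x (j + 1) \<le> bump m (j + 1)"
      using f(1,2) zle by metis+
    have 2: "y x' (i - 1) \<le> bump m (i - 1) \<and> y x' (i + 1) \<le> bump m (i + 1)" if "y x' i < bump m i" for i
    proof (cases "i = j")
      case True
      then show ?thesis using near unfolding y' by auto
    next
      case False
      then have "y x i < bump m i" using that unfolding y' by auto
      from IH(2)[OF this] show ?thesis using y'_le[of "i - 1"] y'_le[of "i + 1"] by linarith
    qed
    have x0': "x0 x' = x0 x" using False unfolding x0_def y' by (auto simp: fun_eq_iff)
    have S: "{i. y x i < bump m i} \<subseteq> {i. y x' i < bump m i}" "j \<in> {i. y x' i < bump m i}"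
      using False unfolding y' by auto
    have "run n {i. y x' i < bump m i} N0 (x0 x') N' x'"
      unfolding x0' by (rule run.fire[OF run_mono[OF IH(4) S(1)] S(2) fire.hyps(2)])
    moreover have "reach n k N0 (x0 x')" unfolding x0' by (rule IH(3))
    ultimately show ?thesis using 1 2 unfolding x0_def by blast
  qed
qed

section \<open>The sorting network\<close>

text \<open>
Unfolding the min-plus recursion of the network backwards from the final tail count at t,
y (i - 1) + weight t i is the cheapest cost of reaching the tail count at i; the tail at i is
reachable iff y i >= t - max i 0.
\<close>

definition weight :: "int \<Rightarrow> int \<Rightarrow> int" where
  "weight t i = max (max (1 - t) (i - t)) (2 * (i - t))"

text \<open>With exactly three chips at j, the new \<open>N j\<close> is at least min (N j) (N (j +
  1) + 2) and the new \<open>N (j + 1)\<close> is at least min (N (j + 1) + 1) (N j). The invariant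
  survives because \<open>y\<close> and \<open>weight\<close> pay for switching between the two
  terms of each minimum.\<close>

lemma late_run:
  assumes "run n S N0 (\<lambda>i. odo (2 * m + 1) i - bump m i) N x" "n = 4 * m + 3" "0 \<le> m" "1 \<le> t"
    and start: "\<And>i. t - max i 0 \<le> bump m i \<Longrightarrow> K \<le> N0 i + bump m (i - 1) + weight t i"
  defines "y \<equiv> \<lambda>x i. odo (2 * m + 1) i - x i"
  shows "staircase (y x) \<and> (\<forall>i. t - max i 0 \<le> y x i \<longrightarrow> K \<le> N i + y x (i - 1) + weight t i)"
  using assms(1)
proof induction
  case stop
  then show ?case using start staircase_bump[OF assms(3)] unfolding y_def by simp
next
  case (fire N x j N' x')
  obtain l r where s: "3 \<le> chips n x j" "x' = x(j := x j + 1)"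
    "N' = N(j := N j - l, j + 1 := N (j + 1) + r)"
    "l = 0 \<and> r = 0 \<and> 3 \<le> chips n x j - (N j - N (j + 1)) \<or>
     l = 0 \<and> r = 1 \<and> 1 \<le> N j - N (j + 1) \<and> 1 \<le> chips n x j - (N j - N (j + 1)) \<or>
     l = 1 \<and> r = 1 \<and> 3 \<le> N j - N (j + 1)"
    using fire.hyps(3) by (rule stepE)
  have y': "y x' = (y x)(j := y x j - 1)" unfolding y_def s(2) by auto
  have xy: "(\<lambda>i. odo (2 * m + 1) i - y x i) = x" unfolding y_def by auto
  have IH: "staircase (y x)" "t - max i 0 \<le> y x i \<Longrightarrow> K \<le> N i + y x (i - 1) + weight t i" for i
    using fire.IH by auto
  note f = staircase_fire[of "y x" "y x" j n m, unfolded xy, OF IH(1) order.refl refl assms(2,3) s(1)]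
  \<comment> \<open>For t >= 1 the slope of \<open>weight t\<close> is 0 up to 1, then 1 up to t,
    then 2.\<close>
  have w: "weight t (j + 1) \<le> weight t j + 2" "0 < j \<Longrightarrow> weight t j + 1 \<le> weight t (j + 1)"
    "j \<le> 0 \<Longrightarrow> weight t (j + 1) = weight t j"
    using assms(4) unfolding weight_def by auto
  have near: "0 < j \<and> y x (j - 1) = y x j \<and> y x (j + 1) = y x j - 1 \<or>
      j < 0 \<and> y x (j + 1) = y x j \<and> y x (j - 1) = y x j - 1 \<or>
      j = 0 \<and> y x (j + 1) = y x j - 1 \<and> y x (j - 1) = y x j - 1"
    using f(5-7) by (meson linorder_cases)
  have "K \<le> N' i + y x' (i - 1) + weight t i" if i: "t - max i 0 \<le> y x' i" for i
  proof -
    consider "i = j" | "i = j + 1" | "i \<noteq> j" "i \<noteq> j + 1" by blast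
    then show ?thesis
    proof cases
      case 1
      have j: "t - max j 0 \<le> y x j - 1" using i unfolding y' 1 by simp
      have Ij: "K \<le> N j + y x (j - 1) + weight t j" by (rule IH(2)) (use j in linarith)
      have "K \<le> N (j + 1) + y x j + weight t (j + 1)"
        using IH(2)[of "j + 1"] j near by auto
      then have "K \<le> N j - l + y x (j - 1) + weight t j"
        using s(4) w near Ij by linarith
      then show ?thesis unfolding y' s(3) 1 by simp
    next
      case 2
      have j: "t - max (j + 1) 0 \<le> y x (j + 1)" using i unfolding y' 2 by simp
      have Ij: "K \<le> N (j + 1) + y x j + weight t (j + 1)" using IH(2)[OF j] by simp
      have "K \<le> N j + y x (j - 1) + weight t j"
        by (rule IH(2)) (use j near in linarith)
      \<comment> \<open>If r = 0, three zeros fill a site of exactly three chips, so N j <= N (j +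
        1).\<close>
      then have "K \<le> N (j + 1) + r + (y x j - 1) + weight t (j + 1)"
        using s(4) w near Ij f(4) by linarith
      then show ?thesis unfolding y' s(3) 2 by simp
    next
      case 3
      then show ?thesis using i IH(2)[of i] s(3) unfolding y' by auto
    qed
  qed
  moreover have "staircase (y x')" unfolding y' by (rule f(3))
  ultimately show ?case by blast
qed

section \<open>Tail bounds at the checkpoint\<close>

lemma chips_odo_bump:
  assumes "0 \<le> m" "i < 0"
  shows "chips n (\<lambda>i. odo (2 * m + 1) i - bump m i) i \<le> 2"
proof -
  have "chips n (\<lambda>i. odo (2 * m + 1) i - bump m i) i
      = chips n (odo (2 * m + 1)) i - (bump m (i - 1) + bump m (i + 1) - 2 * bump m i)"
    unfolding chips_def by simp
  \<comment> \<open>The only concave kink of \<open>bump\<close> is at the origin.\<close>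
  moreover have "0 \<le> bump m (i - 1) + bump m (i + 1) - 2 * bump m i"
    using assms unfolding bump_def by (auto simp: max_def)
  moreover have "chips n (odo (2 * m + 1)) i \<le> 2"
    using assms unfolding chips_odo by auto
  ultimately show ?thesis by linarith
qed

text \<open>The ones are stable left of the origin because all chips are. The least S with k <= 2 *
  S + 2, namely (k - 1) div 2, gives the strongest bound.\<close>

lemma checkpoint_bound_left:
  assumes "reach n k N (\<lambda>i. odo (2 * m + 1) i - bump m i)" "0 \<le> m" "0 \<le> k" "k \<le> n" "i \<le> 0"
  shows "k - max 0 ((k - 1) div 2 + 2 * i) \<le> N i"
proof (rule reach_stable_dominates[OF assms(1) _ _ _ assms(5)])
  show "N i - N (i + 1) \<le> 2" if "i < 0" for i
    using reach_between[OF assms(1,3,4), of i] chips_odo_bump[OF assms(2) that, of n] by linarith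
qed (use assms(3) in linarith)+

lemma checkpoint_bound_right:
  assumes "reach n k N (\<lambda>i. odo (2 * m + 1) i - bump m i)" "n = 4 * m + 3" "0 \<le> m" "0 \<le> k" "k \<le> n" "1 \<le> i"
  shows "2 * bump m i - max 0 ((n - k - 1) div 2 + 2 - 2 * i) \<le> N i"
proof -
  let ?x = "\<lambda>i. odo (2 * m + 1) i - bump m i"
  have "(\<lambda>j. ?x (- j)) = ?x" by (simp add: bump_def)
  then have "reach n (n - k) (flip n k N ?x) ?x" using reach_flip[OF assms(1)] by simp
  from checkpoint_bound_left[OF this assms(3), of "1 - i"]
  have "n - k - max 0 ((n - k - 1) div 2 + 2 - 2 * i) \<le> flip n k N ?x (1 - i)"
    using assms(4-6) by (simp add: algebra_simps)
  moreover have "flip n k N ?x (1 - i) = n - k - (?x (i - 1) - ?x i) + N i"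
  proof -
    have "1 - (1 - i) = i" "- (1 - i) = i - 1" by simp_all
    then show ?thesis using assms(6) unfolding flip_def start_def by simp
  qed
  \<comment> \<open>This is the count of all chips at sites >= i: two on each site from i to
    m.\<close>
  moreover have "?x (i - 1) - ?x i = 2 * bump m i"
  proof -
    have "odo (2 * m + 1) (i - 1) - odo (2 * m + 1) i = max 0 (2 * m + 1 - 2 * (i - 1))"
      using odo_diff_right[of "i - 1" "2 * m + 1"] assms(6) by simp
    then show ?thesis using assms(3,6) unfolding bump_def by auto
  qed
  ultimately show ?thesis by linarith
qed

text \<open>Supplies the initial inequality of \<open>late_run\<close>. The number 2 * (m + 1 - t) +
  1 is the final tail: two chips on each of t, ..., m and one on m + 1.\<close>

lemma checkpoint_weight:
  assumes "reach n k N (\<lambda>i. odo (2 * m + 1) i - bump m i)" "n = 4 * m + 3" "0 \<le> m" "0 \<le> k" "k \<le> n"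
    "1 \<le> t" "t \<le> m + 1" "t - max i 0 \<le> bump m i"
  shows "min k (2 * (m + 1 - t) + 1) \<le> N i + bump m (i - 1) + weight t i"
proof (cases "i \<le> 0")
  case True
  then have b: "bump m (i - 1) = m + i" "t \<le> m + 1 + i" using assms(3,6,8) unfolding bump_def by auto
  have "weight t i = 1 - t" using True assms(6) unfolding weight_def by auto
  moreover have "k - max 0 ((k - 1) div 2 + 2 * i) \<le> N i"
    by (rule checkpoint_bound_left[OF assms(1,3,4,5) True])
  moreover have "2 * ((k - 1) div 2) + 1 \<le> k" "k \<le> 2 * ((k - 1) div 2) + 2" by linarith+
  ultimately show ?thesis using b True by (simp add: min_def max_def split: if_splits)
next
  case False
  then have N: "2 * bump m i - max 0 ((n - k - 1) div 2 + 2 - 2 * i) \<le> N i"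
    using checkpoint_bound_right[OF assms(1-5), of i] by simp
  have w: "i - t \<le> weight t i" "2 * (i - t) \<le> weight t i" unfolding weight_def by auto
  define d where "d = (n - k - 1) div 2"
  have d: "2 * d \<le> 4 * m + 2 - k" "4 * m + 1 - k \<le> 2 * d" unfolding d_def assms(2) by linarith+
  show ?thesis
  proof (cases "i \<le> m + 1")
    case True
    then have "bump m i = m + 1 - i" "bump m (i - 1) = m + 2 - i"
      using False unfolding bump_def by auto
    then show ?thesis using N w d True False assms(4-7) unfolding d_def[symmetric]
      by (simp add: min_def max_def split: if_splits)
  next
    case False
    then have "bump m i = 0" "bump m (i - 1) = 0" using assms(3) unfolding bump_def by auto
    then show ?thesis using N w d False assms(4-7) unfolding d_def[symmetric]
      by (simp add: min_def max_def split: if_splits)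
  qed
qed

section \<open>Tail counts of the final configuration\<close>

lemma terminal_tail_right:
  assumes "reach n k N x" "n = 4 * m + 3" "0 \<le> m" "0 \<le> k" "k \<le> n" "\<And>i. chips n x i \<le> 2"
    "1 \<le> t" "0 < x (t - 1) - x t"
  shows "min k (x (t - 1) - x t) \<le> N t"
proof -
  have x: "x = odo (2 * m + 1)" by (rule terminal_odometer[OF assms(1-3,6)])
  \<comment> \<open>No moves remain at the end, so the checkpoint given by
    \<open>reach_split\<close> is \<open>odo - bump\<close>.\<close>
  have bump0: "max (bump m i) 0 = bump m i" for i unfolding bump_def by simp
  obtain N0 S where N0: "reach n k N0 (\<lambda>i. odo (2 * m + 1) i - bump m i)"
    "run n S N0 (\<lambda>i. odo (2 * m + 1) i - bump m i) N x"
    using reach_split[OF assms(1-3)] unfolding x by (simp add: bump0) blast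
  have d: "x (t - 1) - x t = max 0 (2 * m + 1 - 2 * (t - 1))"
    using odo_diff_right[of "t - 1" "2 * m + 1"] assms(7) unfolding x by simp
  then have t: "t \<le> m + 1" using assms(8) by auto
  \<comment> \<open>The instance i = t of the invariant: both the remaining moves and
    \<open>weight t t\<close> are zero.\<close>
  have "min k (2 * (m + 1 - t) + 1) \<le> N t + (odo (2 * m + 1) (t - 1) - x (t - 1)) + weight t t"
    using late_run[OF N0(2) assms(2,3,7), of "min k (2 * (m + 1 - t) + 1)"]
      checkpoint_weight[OF N0(1) assms(2-5,7) t] assms(7) unfolding x by simp
  moreover have "weight t t = 0" using assms(7) unfolding weight_def by simp
  moreover have "x (t - 1) - x t = 2 * (m + 1 - t) + 1" using d t by simp
  ultimately show ?thesis unfolding x by simp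
qed

text \<open>For s <= 0, flipping turns the zeros left of s into ones at sites >= 1 - s, where the
  bound for positive sites applies; complementing gives the claim.\<close>

lemma terminal_tail:
  assumes "reach n k N x" "n = 4 * m + 3" "0 \<le> m" "0 \<le> k" "k \<le> n" "\<And>i. chips n x i \<le> 2"
  defines "T \<equiv> \<lambda>i. start n i + x (i - 1) - x i"
  assumes "0 < T s" "T s < n"
  shows "min k (T s) \<le> N s"
proof (cases "1 \<le> s")
  case True
  then show ?thesis using terminal_tail_right[OF assms(1-6), of s] assms(8) unfolding T_def start_def by simp
next
  case False
  have T: "T s = n + x (s - 1) - x s" using False unfolding T_def start_def by simp
  have c: "chips n (\<lambda>j. x (- j)) i \<le> 2" for i
  proof -
    have "- (i - 1) = - i + 1" "- (i + 1) = - i - 1" by simp_all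
    then show ?thesis using assms(6)[of "- i"] unfolding chips_def by auto
  qed
  have e: "1 - (1 - s) = s" "- (1 - s) = s - 1" "- (1 - s - 1) = s" by simp_all
  have "min (n - k) (x s - x (s - 1)) \<le> flip n k N x (1 - s)"
    using terminal_tail_right[OF reach_flip[OF assms(1)] assms(2,3) _ _ c, of "1 - s"] assms(4,5,9) False
    unfolding e T by simp
  then show ?thesis using False T unfolding flip_def e start_def by (simp add: min_def split: if_splits)
qed

section \<open>Labeled firing\<close>

definition tail :: "'a set \<Rightarrow> ('a \<Rightarrow> int) \<Rightarrow> int \<Rightarrow> int" where
  "tail A p i = int (card {a \<in> A. i \<le> p a})"

lemma tail_sum: "finite A \<Longrightarrow> tail A p i = (\<Sum>a\<in>A. of_bool (i \<le> p a))"
  by (simp add: tail_def of_bool_def sum.If_cases Int_def)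

lemma tail_update:
  assumes "finite A"
  shows "tail A (p(a := v)) i = tail A p i + (if a \<in> A then of_bool (i \<le> v) - of_bool (i \<le> p a) else 0)"
proof (cases "a \<in> A")
  case True
  have "(\<Sum>b\<in>A - {a}. of_bool (i \<le> (p(a := v)) b)) = (\<Sum>b\<in>A - {a}. of_bool (i \<le> p b) :: int)"
    by (rule sum.cong) auto
  moreover have "tail A q i = of_bool (i \<le> q a) + (\<Sum>b\<in>A - {a}. of_bool (i \<le> q b))" for q
    unfolding tail_sum[OF assms] by (rule sum.remove[OF assms True])
  ultimately show ?thesis using True by (simp only: fun_upd_same if_True)
next
  case False
  then have "{b \<in> A. i \<le> (p(a := v)) b} = {b \<in> A. i \<le> p b}" by auto
  then show ?thesis using False unfolding tail_def by simp
qed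

lemma tail_diff:
  assumes "finite A"
  shows "tail A p i - tail A p (i + 1) = int (card {a \<in> A. p a = i})"
proof -
  have "{a \<in> A. i \<le> p a} = {a \<in> A. p a = i} \<union> {a \<in> A. i + 1 \<le> p a}" by auto
  then have "card {a \<in> A. i \<le> p a} = card {a \<in> A. p a = i} + card {a \<in> A. i + 1 \<le> p a}"
    using assms by (auto intro: card_Un_disjoint)
  then show ?thesis unfolding tail_def by simp
qed

lemma card_ge_3:
  assumes "finite A" "a \<in> A" "b \<in> A" "c \<in> A" "a < b" "b < (c :: 'a :: linorder)"
  shows "3 \<le> card A"
proof -
  have "card {a, b, c} \<le> card A" using assms by (intro card_mono) auto
  moreover have "a \<noteq> b" "a \<noteq> c" "b \<noteq> c" using assms(5,6) by auto
  ultimately show ?thesis by simp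
qed

text \<open>As B is closed upwards, its members among a < b < c form a final segment. This gives l
  <= r and the colour conditions of \<open>step\<close>.\<close>

lemma fire_move_step:
  assumes "finite L" "B \<subseteq> L" and up: "\<forall>a\<in>B. \<forall>b\<in>L. a < b \<longrightarrow> b \<in> B"
    and "fire_move L p q" and T: "\<And>i. tail L p i = start n i + x (i - 1) - x i"
  shows "\<exists>i. step n i (tail B p) x (tail B q) (x(i := x i + 1)) \<and>
    (\<forall>j. tail L q j = start n j + (x(i := x i + 1)) (j - 1) - (x(i := x i + 1)) j)"
proof -
  obtain a b c where m: "a \<in> L" "b \<in> L" "c \<in> L" "a < b" "b < c" "p a = p b" "p b = p c"
    "q = p(a := p a - 1, c := p c + 1)"
    using assms(4) unfolding fire_move_def by blast
  define i where "i = p a"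
  have pi: "p a = i" "p b = i" "p c = i" using m unfolding i_def by auto
  have B: "finite B" "finite (L - B)" using assms(1,2) finite_subset by auto
  have upd: "tail A q j = tail A p j - of_bool (j = i \<and> a \<in> A) + of_bool (j = i + 1 \<and> c \<in> A)"
    if "finite A" for A j
    using m(4,5) pi unfolding m(8) tail_update[OF that] by auto
  have chips: "chips n x i = tail L p i - tail L p (i + 1)"
    unfolding T chips_def start_def by simp
  have zeros: "chips n x i - (tail B p i - tail B p (i + 1)) = int (card {y \<in> L - B. p y = i})"
  proof -
    have "{y \<in> L. p y = i} = {y \<in> B. p y = i} \<union> {y \<in> L - B. p y = i}" using assms(2) by auto
    then have "card {y \<in> L. p y = i} = card {y \<in> B. p y = i} + card {y \<in> L - B. p y = i}"
      using B by (auto intro: card_Un_disjoint)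
    then show ?thesis unfolding chips tail_diff[OF assms(1)] tail_diff[OF B(1)] by simp
  qed
  have three: "3 \<le> int (card {y \<in> A. p y = i})" if "finite A" "a \<in> A" "b \<in> A" "c \<in> A" for A
    using card_ge_3[of "{y \<in> A. p y = i}" a b c] that m pi by simp
  have one: "1 \<le> int (card {y \<in> A. p y = i})" if "finite A" "y \<in> A" "p y = i" for A y
    using that card_gt_0_iff[of "{y \<in> A. p y = i}"] by (auto simp: Suc_le_eq)
  have ab: "a \<in> B \<Longrightarrow> b \<in> B" "b \<in> B \<Longrightarrow> c \<in> B" using up m by blast+
  define l :: int where "l = of_bool (a \<in> B)"
  define r :: int where "r = of_bool (c \<in> B)"
  have "step n i (tail B p) x (tail B q) (x(i := x i + 1))"
  proof (rule stepI[of _ _ _ l r])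
    show "3 \<le> chips n x i" unfolding chips tail_diff[OF assms(1)] using three[OF assms(1)] m by blast
    show "0 \<le> l" "l \<le> r" "r \<le> 1" using ab unfolding l_def r_def by auto
    show "tail B q = (tail B p)(i := tail B p i - l, i + 1 := tail B p (i + 1) + r)"
      using upd[OF B(1)] unfolding l_def r_def by (auto simp: fun_eq_iff)
    show "3 \<le> tail B p i - tail B p (i + 1)" if "l = 1"
      unfolding tail_diff[OF B(1)] using three[OF B(1)] that ab unfolding l_def by auto
    show "1 \<le> tail B p i - tail B p (i + 1)" if "r = 1"
      unfolding tail_diff[OF B(1)] using one[OF B(1), of c] that pi unfolding r_def by auto
    show "3 \<le> chips n x i - (tail B p i - tail B p (i + 1))" if "r = 0"
      unfolding zeros using three[OF B(2)] that ab m unfolding r_def by auto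
    show "1 \<le> chips n x i - (tail B p i - tail B p (i + 1))" if "l = 0"
      unfolding zeros using one[OF B(2), of a] that pi m unfolding l_def by auto
  qed
  moreover have "tail L q j = start n j + (x(i := x i + 1)) (j - 1) - (x(i := x i + 1)) j" for j
    using upd[OF assms(1), of j] T[of j] m by auto
  ultimately show ?thesis by blast
qed

lemma fire_moves_reach:
  assumes "finite L" "B \<subseteq> L" and up: "\<forall>a\<in>B. \<forall>b\<in>L. a < b \<longrightarrow> b \<in> B"
    and "(fire_move L)\<^sup>*\<^sup>* (\<lambda>_. 0) p"
  shows "\<exists>x. reach (int (card L)) (int (card B)) (tail B p) x \<and>
    (\<forall>i. tail L p i = start (int (card L)) i + x (i - 1) - x i)"
  using assms(4)
proof induction
  case base
  have "tail A (\<lambda>_. 0) = start (int (card A))" for A :: "'a set"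
    by (auto simp: tail_def start_def fun_eq_iff)
  then show ?case using reach.init by (intro exI[of _ "\<lambda>_. 0"]) simp
next
  case (step p q)
  then obtain x where x: "reach (int (card L)) (int (card B)) (tail B p) x"
    "\<And>i. tail L p i = start (int (card L)) i + x (i - 1) - x i" by blast
  show ?case
    using fire_move_step[OF assms(1,2) up step.hyps(2) x(2)] reach.fire[OF x(1)] by blast
qed

theorem theorem3p13:
  fixes L :: "'a::linorder set" and n :: nat and p :: "'a \<Rightarrow> int"
  assumes "finite L" and "card L = n" and "n mod 4 = 3"
    and "(fire_move L)\<^sup>*\<^sup>* (\<lambda>_. 0) p"
    and "terminal L p"
  shows "\<forall>a\<in>L. \<forall>b\<in>L. a < b \<longrightarrow> p a \<le> p b"
proof (intro ballI impI, rule ccontr)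
  fix a b assume ab: "a \<in> L" "b \<in> L" "a < b" "\<not> p a \<le> p b"
  \<comment> \<open>With this threshold a is a zero in the tail at \<open>p a\<close> and b is a one
    outside it, so that tail contains a zero while missing a one.\<close>
  define B where "B = {c \<in> L. a < c}"
  have B: "B \<subseteq> L" "finite B" using assms(1) unfolding B_def by auto
  obtain x where x: "reach (int n) (int (card B)) (tail B p) x"
    "\<And>i. tail L p i = start (int n) i + x (i - 1) - x i"
    using fire_moves_reach[OF assms(1) B(1) _ assms(4)] unfolding assms(2) B_def by force
  have stable: "chips (int n) x i \<le> 2" for i
  proof -
    have "chips (int n) x i = tail L p i - tail L p (i + 1)"
      unfolding x(2) chips_def start_def by simp
    also have "\<dots> \<le> 2" using assms(5) unfolding tail_diff[OF assms(1)] terminal_def by simp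
    finally show ?thesis .
  qed
  have "n = 4 * (n div 4) + 3" using assms(3) by presburger
  then have n: "int n = 4 * int (n div 4) + 3" by presburger
  have k: "int (card B) \<le> int n" using card_mono[OF assms(1) B(1)] assms(2) by simp
  have less: "tail B p (p a) < tail L p (p a)"
  proof -
    have "{c \<in> B. p a \<le> p c} \<subset> {c \<in> L. p a \<le> p c}" using ab B(1) unfolding B_def by auto
    then have "card {c \<in> B. p a \<le> p c} < card {c \<in> L. p a \<le> p c}"
      by (intro psubset_card_mono) (use assms(1) in auto)
    then show ?thesis unfolding tail_def by simp
  qed
  have less_card: "tail A p (p a) < int (card A)" if "finite A" "b \<in> A" for A
  proof -
    have "{c \<in> A. p a \<le> p c} \<subset> A" using ab that by auto
    then have "card {c \<in> A. p a \<le> p c} < card A" by (rule psubset_card_mono[OF that(1)])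
    then show ?thesis unfolding tail_def by simp
  qed
  have "tail B p (p a) < int (card B)" "tail L p (p a) < int n"
    using less_card[OF B(2)] less_card[OF assms(1)] ab assms(2) unfolding B_def by auto
  moreover have "0 \<le> tail B p (p a)" unfolding tail_def by simp
  ultimately have "min (int (card B)) (tail L p (p a)) \<le> tail B p (p a)"
    using terminal_tail[OF x(1) n _ _ k stable, of "p a"] less unfolding x(2)[symmetric] by simp
  then show False using less \<open>tail B p (p a) < int (card B)\<close> by simp
qed

end
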